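(* Let $\mu^{(1)},\dots,\mu^{(d)}$ be the submodels of the facet process defined in the context. The facet process $\mu^{(1)}$ is neither strictly attractive nor strictly repulsive, for any $\nu_1\in\mathbb R$. The facet processes $\mu^{(k)}$ are repulsive for $k=2,\dots,d$.
   Context: Let $d\in\mathbb N$, $B\subset\mathbb R^d$ a bounded Borel set of positive Lebesgue measure, $b>0$, and $Y=B\times(0,b]\times\mathbb S^{d-1}$, where $\mathbb S^{d-1}$ denotes the hemisphere of axial orientations in $\mathbb R^d$. A point $y=(z,r,\phi)\in Y$ represents the facet $\{s\in A:\ \mathrm{dist}(s,z)\le r\}$, where $A=A(z,\phi)$ is the hyperplane through $z$ with normal orientation $\phi$ and $\mathrm{dist}$ is a distance in $A$; $y$ also denotes this facet. $\eta$ is the Poisson process on $Y$ with intensity measure $\lambda(\mathrm d(z,r,\phi))=\chi(z)\,\mathrm dz\,Q(\mathrm dr)\,V(\mathrm d\phi)$, where $\chi$ is a bounded intensity function on $B$, $Q$ is a probability measure on $(0,b]$ and $V$ is a probability measure on $\mathbb S^{d-1}$ which has a density with respect to Lebesgue measure (or, more generally, has at least $d$ atoms). $\mathbf N$ is the set of finite configurations of points of $Y$. For $\mathbf x\in\mathbf N$ and $j=1,\dots,d$, $$G_j(\mathbf x)=\frac1{j!}\sum_{(y_1,\dots,y_j)\in\mathbf x^j_{\neq}}\mathbb H^{d-j}\Big(\bigcap_{i=1}^jy_i\Big),$$ where $\mathbb H^{i}$ is the $i$-dimensional Hausdorff measure, $\mathbf x^j_{\neq}$ is the set of ordered $j$-tuples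 of distinct points of $\mathbf x$, and only tuples of facets whose hyperplanes are in general position are considered. For $k\in\{1,\dots,d\}$, $\mu^{(k)}$ is the point process with density $p(\mathbf x)=c\exp(\nu_kG_k(\mathbf x))$ with respect to the distribution of $\eta$, where $c$ is the normalizing constant; here $\nu_k\le0$ for $k=2,\dots,d$, and $\nu_1\in\mathbb R$ is arbitrary for $k=1$. The conditional intensity is $\lambda^*(y;\mathbf x)=p(\mathbf x\cup\{y\})/p(\mathbf x)$ for $y\in Y\setminus\mathbf x$. A process is attractive if $\lambda^*(y;\mathbf x_1)\ge\lambda^*(y;\mathbf x_2)$ for any $\mathbf x_1,\mathbf x_2\in\mathbf N$ with $\mathbf x_2\subset\mathbf x_1$ (and $y\notin\mathbf x_1$); it is repulsive if $\lambda^*(y;\mathbf x_1)\le\lambda^*(y;\mathbf x_2)$ for any such $\mathbf x_1,\mathbf x_2,y$. It is strictly attractive, respectively strictly repulsive, if the corresponding inequality is strict (for $\mathbf x_2\ne\mathbf x_1$). *)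

theory Defs
  imports "HOL-Probability.Probability"
begin

text \<open>Hausdorff measure, with the constant that makes \<open>H\<^sup>n\<close> agree with Lebesgue
  measure on \<open>n\<close>-dimensional flats, and with \<open>H\<^sup>0\<close> counting points. Empty members of a
  covering contribute nothing, also for \<open>n = 0\<close>. The boundedness condition is needed because
  \<^const>\<open>diameter\<close> is unspecified on unbounded sets.\<close>

definition hausdorff_pre :: "nat \<Rightarrow> real \<Rightarrow> 'a::euclidean_space set \<Rightarrow> ennreal" where
  "hausdorff_pre n \<epsilon> E =
     (INF U \<in> {U :: nat \<Rightarrow> 'a set. E \<subseteq> (\<Union>i. U i) \<and> (\<forall>i. bounded (U i) \<and> diameter (U i) \<le> \<epsilon>)}.
        \<Sum>i. if U i = {} then 0
             else ennreal (unit_ball_vol (real n) * (diameter (U i) / 2) ^ n))"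

definition hausdorff :: "nat \<Rightarrow> 'a::euclidean_space set \<Rightarrow> ennreal" where
  "hausdorff n E = (SUP \<epsilon> \<in> {0<..}. hausdorff_pre n \<epsilon> E)"


text \<open>A facet parameter is a triple \<open>(z, r, \<phi>)\<close>. The facet itself depends on a family \<open>\<delta>\<close>
  assigning to every hyperplane \<open>A\<close> a metric \<open>\<delta> A\<close> on \<open>A\<close>.\<close>

type_synonym 'a param = "'a \<times> real \<times> 'a"

definition hyperplane :: "'a::euclidean_space param \<Rightarrow> 'a set" where
  "hyperplane = (\<lambda>(z, r, \<phi>). {s. \<phi> \<bullet> (s - z) = 0})"

definition facet :: "('a set \<Rightarrow> 'a \<Rightarrow> 'a \<Rightarrow> real) \<Rightarrow> 'a::euclidean_space param \<Rightarrow> 'a set" where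
  "facet \<delta> = (\<lambda>(z, r, \<phi>). {s \<in> hyperplane (z, r, \<phi>). \<delta> (hyperplane (z, r, \<phi>)) s z \<le> r})"

text \<open>Any \<open>m\<close> of the hyperplanes meet in a flat of dimension \<open>d - m\<close>, and have empty
  intersection (dimension \<open>-1\<close>) if \<open>m > d\<close>.\<close>

definition general_position :: "'a::euclidean_space param set \<Rightarrow> bool" where
  "general_position S \<longleftrightarrow>
     (\<forall>T\<subseteq>S. aff_dim (\<Inter>y\<in>T. hyperplane y) = max (-1) (int DIM('a) - int (card T)))"

text \<open>The Hausdorff measures occurring here are finite as soon as facets are bounded, so
  passing to real values loses nothing.\<close>

definition facet_G ::
  "('a set \<Rightarrow> 'a \<Rightarrow> 'a \<Rightarrow> real) \<Rightarrow> nat \<Rightarrow> 'a::euclidean_space param set \<Rightarrow> real" where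
  "facet_G \<delta> j x = 1 / fact j *
     (\<Sum>ys \<in> {ys. length ys = j \<and> distinct ys \<and> set ys \<subseteq> x \<and> general_position (set ys)}.
        enn2real (hausdorff (DIM('a) - j) (\<Inter>y\<in>set ys. facet \<delta> y)))"


text \<open>Axial orientations are represented by a Borel set of unit vectors containing exactly one
  of each antipodal pair.\<close>

definition axial_hemisphere :: "'a::euclidean_space set \<Rightarrow> bool" where
  "axial_hemisphere H \<longleftrightarrow>
     H \<in> sets borel \<and> H \<subseteq> sphere 0 1 \<and> (\<forall>\<phi>\<in>sphere 0 1. \<phi> \<in> H \<longleftrightarrow> - \<phi> \<notin> H)"

text \<open>Surface measure on the unit sphere via the cone formula: \<open>d\<close> times the volume of
  the cone over the given set. Counting measure for \<open>d = 1\<close>.\<close>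

definition sphere_lebesgue :: "'a::euclidean_space measure" where
  "sphere_lebesgue = scale_measure (of_nat DIM('a))
     (distr (restrict_space lborel (ball 0 1 - {0})) borel (\<lambda>x. x /\<^sub>R norm x))"

locale facet_model =
  fixes B :: "'a::euclidean_space set"
    and b :: real
    and H :: "'a set"
    and \<delta> :: "'a set \<Rightarrow> 'a \<Rightarrow> 'a \<Rightarrow> real"
    and \<kappa> :: "'a \<Rightarrow> real"
    and Q :: "real measure"
    and V :: "'a measure"
  assumes B: "B \<in> sets borel" "bounded B" "emeasure lborel B > 0"
    and b: "b > 0"
    and H: "axial_hemisphere H"
    and \<delta>: "\<And>z r \<phi>. \<phi> \<in> H \<Longrightarrow> Metric_space (hyperplane (z, r, \<phi>)) (\<delta> (hyperplane (z, r, \<phi>)))"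
    and \<kappa>: "\<kappa> \<in> borel_measurable (restrict_space borel B)"
      "\<And>z. z \<in> B \<Longrightarrow> 0 \<le> \<kappa> z" "bdd_above (\<kappa> ` B)"
    and Q: "prob_space Q" "sets Q = sets (restrict_space borel {0<..b})"
    and V: "prob_space V" "sets V = sets (restrict_space borel H)"
      "(\<exists>f \<in> borel_measurable (restrict_space borel H).
          V = density (restrict_space sphere_lebesgue H) f) \<or>
       (\<exists>T\<subseteq>H. card T = DIM('a) \<and> (\<forall>\<phi>\<in>T. measure V {\<phi>} > 0))"

text \<open>The underlying space of this measure is \<open>Y = B \<times> (0,b] \<times> H\<close>.\<close>

definition facet_intensity ::
  "'a::euclidean_space set \<Rightarrow> ('a \<Rightarrow> real) \<Rightarrow> real measure \<Rightarrow> 'a measure \<Rightarrow> 'a param measure" where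
  "facet_intensity B \<kappa> Q V = density (restrict_space lborel B) (\<lambda>z. ennreal (\<kappa> z)) \<Otimes>\<^sub>M (Q \<Otimes>\<^sub>M V)"


definition configs :: "'y set \<Rightarrow> 'y set set" where
  "configs Y = {x. finite x \<and> x \<subseteq> Y}"

definition config_space :: "'y measure \<Rightarrow> 'y set measure" where
  "config_space L = sigma (configs (space L))
     {{x \<in> configs (space L). card (x \<inter> A) = n} | A n. A \<in> sets L}"

text \<open>A Poisson process with finite intensity measure \<open>L\<close>, seen as a random finite set; this
  is appropriate for diffuse \<open>L\<close>, where there are almost surely no multiple points.\<close>

definition poisson_process :: "'w measure \<Rightarrow> 'y measure \<Rightarrow> ('w \<Rightarrow> 'y set) \<Rightarrow> bool" where
  "poisson_process M L \<eta> \<longleftrightarrow>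
     prob_space M \<and>
     \<eta> \<in> M \<rightarrow>\<^sub>M config_space L \<and>
     (\<forall>A\<in>sets L. \<forall>n. measure M {w \<in> space M. card (\<eta> w \<inter> A) = n} =
        exp (- measure L A) * measure L A ^ n / fact n) \<and>
     (\<forall>(A :: nat \<Rightarrow> 'y set) I. A ` I \<subseteq> sets L \<longrightarrow> disjoint_family_on A I \<longrightarrow>
        prob_space.indep_vars M (\<lambda>_. count_space UNIV) (\<lambda>i w. card (\<eta> w \<inter> A i)) I)"

text \<open>The density \<open>p = c exp (t G\<^sub>k)\<close> with respect to a distribution \<open>P\<close> on configurations.\<close>

definition submodel_density ::
  "'a::euclidean_space param set measure \<Rightarrow> ('a set \<Rightarrow> 'a \<Rightarrow> 'a \<Rightarrow> real) \<Rightarrow> nat \<Rightarrow> real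
     \<Rightarrow> 'a param set \<Rightarrow> real" where
  "submodel_density P \<delta> k t x =
     1 / (\<integral>x'. exp (t * facet_G \<delta> k x') \<partial>P) * exp (t * facet_G \<delta> k x)"


text \<open>A process is given through its density \<open>p\<close>, a function on all of \<open>configs Y\<close>.\<close>

definition cond_intensity :: "('y set \<Rightarrow> real) \<Rightarrow> 'y \<Rightarrow> 'y set \<Rightarrow> real" where
  "cond_intensity p y x = p (x \<union> {y}) / p x"

definition repulsive :: "'y set \<Rightarrow> ('y set \<Rightarrow> real) \<Rightarrow> bool" where
  "repulsive Y p \<longleftrightarrow> (\<forall>x1 \<in> configs Y. \<forall>x2 \<in> configs Y. \<forall>y \<in> Y - x1.
     x2 \<subseteq> x1 \<longrightarrow> cond_intensity p y x1 \<le> cond_intensity p y x2)"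

definition strictly_attractive :: "'y set \<Rightarrow> ('y set \<Rightarrow> real) \<Rightarrow> bool" where
  "strictly_attractive Y p \<longleftrightarrow> (\<forall>x1 \<in> configs Y. \<forall>x2 \<in> configs Y. \<forall>y \<in> Y - x1.
     x2 \<subset> x1 \<longrightarrow> cond_intensity p y x1 > cond_intensity p y x2)"

definition strictly_repulsive :: "'y set \<Rightarrow> ('y set \<Rightarrow> real) \<Rightarrow> bool" where
  "strictly_repulsive Y p \<longleftrightarrow> (\<forall>x1 \<in> configs Y. \<forall>x2 \<in> configs Y. \<forall>y \<in> Y - x1.
     x2 \<subset> x1 \<longrightarrow> cond_intensity p y x1 < cond_intensity p y x2)"

end

theory Submission
  imports Defs
begin

text \<open>Adding a facet \<open>y\<close> to \<open>x\<close> raises \<open>G\<^sub>k\<close> by the contribution of the tuples through \<open>y\<close>, a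
  sum of nonnegative terms over a set of tuples that grows with \<open>x\<close>. The conditional intensity
  is the exponential of \<open>\<nu>\<^sub>k\<close> times this increment. For \<open>k = 1\<close> the only tuple through \<open>y\<close> is
  \<open>y\<close> itself, so the conditional intensity does not depend on \<open>x\<close> at all.\<close>

definition facet_tuples :: "nat \<Rightarrow> 'a::euclidean_space param set \<Rightarrow> 'a param list set" where
  "facet_tuples j x =
     {ys. length ys = j \<and> distinct ys \<and> set ys \<subseteq> x \<and> general_position (set ys)}"

lemma finite_facet_tuples:
  assumes "finite x"
  shows "finite (facet_tuples j x)"
  by (rule finite_subset[OF _ finite_lists_length_eq[OF assms, of j]])
     (auto simp: facet_tuples_def)

lemma facet_G_insert_diff:
  fixes x :: "'a::euclidean_space param set"
  assumes "finite x" "y \<notin> x"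
  shows "facet_G \<delta> j (insert y x) - facet_G \<delta> j x =
    1 / fact j * (\<Sum>ys \<in> {ys \<in> facet_tuples j (insert y x). y \<in> set ys}.
      enn2real (hausdorff (DIM('a) - j) (\<Inter>y\<in>set ys. facet \<delta> y)))"
proof -
  let ?new = "{ys \<in> facet_tuples j (insert y x). y \<in> set ys}"
  let ?h = "\<lambda>ys. enn2real (hausdorff (DIM('a) - j) (\<Inter>y\<in>set ys. facet \<delta> y))"
  \<comment> \<open>Since \<open>general_position\<close> is tested on the tuple alone, the tuples
    over \<open>insert y x\<close> that avoid \<open>y\<close> are exactly those over
    \<open>x\<close>.\<close>
  have split: "facet_tuples j (insert y x) = facet_tuples j x \<union> ?new"
    and disj: "facet_tuples j x \<inter> ?new = {}"
    using \<open>y \<notin> x\<close> by (auto simp: facet_tuples_def)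
  have "sum ?h (facet_tuples j (insert y x)) = sum ?h (facet_tuples j x) + sum ?h ?new"
    using finite_facet_tuples[of x j] finite_facet_tuples[of "insert y x" j] \<open>finite x\<close> disj
    by (subst split, intro sum.union_disjoint) auto
  then show ?thesis
    by (simp add: facet_G_def facet_tuples_def[symmetric] field_simps)
qed

text \<open>The increment at the empty configuration serves as a reference value shared by all
  \<open>x\<close>.\<close>

lemma facet_G_1_insert_diff:
  assumes "finite x" "y \<notin> x"
  shows "facet_G \<delta> 1 (insert y x) - facet_G \<delta> 1 x = facet_G \<delta> 1 {y} - facet_G \<delta> 1 {}"
proof -
  have "{ys \<in> facet_tuples 1 (insert y x). y \<in> set ys} = {ys \<in> facet_tuples 1 {y}. y \<in> set ys}"
    by (auto simp: facet_tuples_def length_Suc_conv)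
  with facet_G_insert_diff[OF assms, of \<delta> 1] facet_G_insert_diff[of "{}" y \<delta> 1]
  show ?thesis by simp
qed

lemma facet_G_insert_diff_mono:
  assumes "finite x1" "x2 \<subseteq> x1" "y \<notin> x1"
  shows "facet_G \<delta> j (insert y x2) - facet_G \<delta> j x2 \<le> facet_G \<delta> j (insert y x1) - facet_G \<delta> j x1"
proof -
  have "finite x2" "y \<notin> x2"
    using assms finite_subset by auto
  moreover have "{ys \<in> facet_tuples j (insert y x2). y \<in> set ys}
      \<subseteq> {ys \<in> facet_tuples j (insert y x1). y \<in> set ys}"
    using \<open>x2 \<subseteq> x1\<close> by (auto simp: facet_tuples_def)
  \<comment> \<open>The extra tuples over the larger configuration contribute values of
    \<open>enn2real\<close>, which are nonnegative.\<close>
  ultimately show ?thesis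
    using assms finite_facet_tuples[of "insert y x1" j]
    by (simp add: facet_G_insert_diff divide_right_mono sum_mono2)
qed

text \<open>If the partition function has the junk value 0 (no integrability is established here),
  then the density and the conditional intensity vanish identically.\<close>

lemma cond_intensity_submodel_density:
  "cond_intensity (submodel_density P \<delta> k t) y x =
     (if (\<integral>x'. exp (t * facet_G \<delta> k x') \<partial>P) = 0 then 0
      else exp (t * (facet_G \<delta> k (insert y x) - facet_G \<delta> k x)))"
  by (simp add: cond_intensity_def submodel_density_def right_diff_distrib exp_diff)

text \<open>A factor \<open>t \<le> 0\<close> reverses the monotonicity of the increments, and
  \<open>exp\<close> preserves order. If the partition function is 0, both sides are 0.\<close>

lemma repulsive_submodel_density:
  assumes "t \<le> 0"
  shows "repulsive Y (submodel_density P \<delta> k t)"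
  unfolding repulsive_def
  using assms facet_G_insert_diff_mono
  by (auto simp: cond_intensity_submodel_density configs_def intro!: mult_left_mono_neg)

lemma cond_intensity_submodel_density_1:
  assumes "finite x1" "finite x2" "y \<notin> x1" "y \<notin> x2"
  shows "cond_intensity (submodel_density P \<delta> 1 t) y x1 =
         cond_intensity (submodel_density P \<delta> 1 t) y x2"
  using facet_G_1_insert_diff[OF assms(1,3), of \<delta>] facet_G_1_insert_diff[OF assms(2,4), of \<delta>]
  by (simp only: cond_intensity_submodel_density)

text \<open>Equal conditional intensities at \<open>{}\<close> and \<open>{y'}\<close> violate both
  strict inequalities; \<open>y\<close> is the point added.\<close>

lemma submodel_density_1_not_strict:
  assumes "y \<in> Y" "y' \<in> Y" "y \<noteq> y'"
  shows "\<not> strictly_attractive Y (submodel_density P \<delta> 1 t)"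
    and "\<not> strictly_repulsive Y (submodel_density P \<delta> 1 t)"
proof -
  have "{} \<in> configs Y" "{y'} \<in> configs Y" "{} \<subset> {y'}" "y \<in> Y - {y'}"
    using assms by (auto simp: configs_def)
  moreover have "cond_intensity (submodel_density P \<delta> 1 t) y {y'} =
      cond_intensity (submodel_density P \<delta> 1 t) y {}"
    using assms by (intro cond_intensity_submodel_density_1) auto
  ultimately show "\<not> strictly_attractive Y (submodel_density P \<delta> 1 t)"
    and "\<not> strictly_repulsive Y (submodel_density P \<delta> 1 t)"
    unfolding strictly_attractive_def strictly_repulsive_def by (metis less_irrefl)+
qed

lemma axial_hemisphere_nonempty:
  assumes "axial_hemisphere H"
  shows "H \<noteq> {}"
proof -
  obtain \<phi> :: 'a where "\<phi> \<in> sphere 0 1"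
    using vector_choose_size[of 1] by auto
  \<comment> \<open>One of \<phi> and its antipode lies in \<open>H\<close>.\<close>
  with assms show ?thesis
    by (auto simp: axial_hemisphere_def)
qed

theorem proposition2:
  fixes B H :: "(real ^ 'd) set"
    and b :: real
    and \<delta> :: "(real ^ 'd) set \<Rightarrow> real ^ 'd \<Rightarrow> real ^ 'd \<Rightarrow> real"
    and \<kappa> :: "real ^ 'd \<Rightarrow> real"
    and Q :: "real measure"
    and V :: "(real ^ 'd) measure"
    and M :: "'w measure"
    and \<eta> :: "'w \<Rightarrow> (real ^ 'd) param set"
    and \<nu> :: "nat \<Rightarrow> real"
  defines "Y \<equiv> B \<times> {0<..b} \<times> H"
    and "p \<equiv> \<lambda>k. submodel_density (distr M (config_space (facet_intensity B \<kappa> Q V)) \<eta>) \<delta> k (\<nu> k)"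
  assumes model: "facet_model B b H \<delta> \<kappa> Q V"
    and poisson: "poisson_process M (facet_intensity B \<kappa> Q V) \<eta>"
    and \<nu>: "\<And>k. k \<in> {2..CARD('d)} \<Longrightarrow> \<nu> k \<le> 0"
  shows "\<not> strictly_attractive Y (p 1) \<and> \<not> strictly_repulsive Y (p 1) \<and>
         (\<forall>k\<in>{2..CARD('d)}. repulsive Y (p k))"
proof -
  interpret facet_model B b H \<delta> \<kappa> Q V by (rule model)
  \<comment> \<open>\<open>B\<close> is nonempty because its measure is positive.\<close>
  obtain z \<phi> where "z \<in> B" "\<phi> \<in> H"
    using B(3) axial_hemisphere_nonempty[OF H] by fastforce
  \<comment> \<open>Two distinct points of \<open>Y\<close> arise by varying only the radius, as
    \<open>b > 0\<close> puts both \<open>b\<close> and \<open>b / 2\<close> in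
    \<open>{0<..b}\<close>.\<close>
  then have "(z, b, \<phi>) \<in> Y" "(z, b / 2, \<phi>) \<in> Y" "(z, b, \<phi>) \<noteq> (z, b / 2, \<phi>)"
    using b by (auto simp: Y_def)
  from submodel_density_1_not_strict[OF this] show ?thesis
    by (auto simp: p_def intro!: repulsive_submodel_density \<nu>)
qed

end
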